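(* For $k\in\mathbb{R}\setminus\{0\}$ and $x\in\mathbb{R}$, $$e(x,k)=(\mathrm{sign}(k))^n\left(\prod_{j=1}^n\frac{1}{j+i|k|}\right)P_n(x,ik)\,e^{ikx},$$ where $P_n(x,ik)=p_n(\tanh x,ik)$ is defined by the recursion formula $$p_m(\tanh x,ik)=\frac{d}{dx}\,p_{m-1}(\tanh x,ik)+(ik-m\tanh x)\,p_{m-1}(\tanh x,ik),\qquad m\ge 1,\quad p_0=1.$$ In particular, the function $\mathbb{R}\times(\mathbb{R}\setminus\{0\})\ni(x,k)\mapsto e(x,k)\in\mathbb{C}$ is (real) analytic, and $e(x,-k)=e(-x,k)$. Finally, the function $$(x,y,k)\mapsto e(x,k)\overline{e(y,k)}=\left(\prod_{j=1}^n\frac{1}{j^2+k^2}\right)P_n(x,ik)\,P_n(y,-ik)\,e^{ik(x-y)}$$ is real analytic on $\mathbb{R}^3$ (at $k=0$ it is understood as given by the right-hand side).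
   Context: Let $n\in\mathbb{N}_0$, $\lambda=n+1$, $V(x)=-\lambda(\lambda-1)\,\mathrm{sech}^2x=-n(n+1)\,\mathrm{sech}^2 x$, and $H=-d^2/dx^2+V$ on $\mathbb{R}$. For real $k\ne0$, $e(x,k)$ denotes the solution of $He(\cdot,k)=k^2e(\cdot,k)$ with the scattering asymptotics: for $k>0$, $e(x,k)=e_+(x,k)$ with $e_+(x,k)\sim T_+(k)e^{ikx}$ as $x\to+\infty$ and $e_+(x,k)\sim e^{ikx}+R_+(k)e^{-ikx}$ as $x\to-\infty$; for $k<0$, $e(x,k)=e_-(x,k)$ with $e_-(x,k)\sim T_-(k)e^{ikx}$ as $x\to-\infty$ and $e_-(x,k)\sim e^{ikx}+R_-(k)e^{-ikx}$ as $x\to+\infty$, for some constants $T_\pm(k),R_\pm(k)$. Equivalently, $e(x,k)$ solves the Lippmann--Schwinger equation $e(x,k)=e^{ikx}+\frac{1}{2i|k|}\int e^{i|k||x-y|}V(y)e(y,k)\,dy$. $P_n(y,-ik)$ denotes $p_n(\tanh y,-ik)$, i.e. $P_n(y,ik)$ with $k$ replaced by $-k$; empty products equal $1$. *)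

theory Defs
  imports "HOL-Analysis.Analysis"
begin

text \<open>Poeschl--Teller potential \<open>-\<lambda>(\<lambda> - 1) sech\<^sup>2 x\<close> with \<open>\<lambda> = n + 1\<close>.\<close>

definition V :: "nat \<Rightarrow> real \<Rightarrow> real" where
  "V n x = - (real n * (real n + 1)) * (1 / cosh x)\<^sup>2"

definition schroedinger_solution :: "nat \<Rightarrow> real \<Rightarrow> (real \<Rightarrow> complex) \<Rightarrow> bool" where
  "schroedinger_solution n k f \<longleftrightarrow>
     (\<exists>f' f''. \<forall>x. (f has_vector_derivative f' x) (at x) \<and>
                   (f' has_vector_derivative f'' x) (at x) \<and>
                   - f'' x + of_real (V n x) * f x = of_real (k\<^sup>2) * f x)"

text \<open>An asymptotic relation \<open>f \<sim> g\<close> at infinity means that \<open>f - g\<close> tends to zero (not that the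
  quotient tends to one, which would be meaningless if \<open>g\<close> had zeros).\<close>

definition scattering_solution :: "nat \<Rightarrow> real \<Rightarrow> (real \<Rightarrow> complex) \<Rightarrow> bool" where
  "scattering_solution n k f \<longleftrightarrow>
     schroedinger_solution n k f \<and>
     (\<exists>T R :: complex.
        (k > 0 \<longrightarrow>
           ((\<lambda>x. f x - T * exp (\<i> * of_real (k * x))) \<longlongrightarrow> 0) at_top \<and>
           ((\<lambda>x. f x - (exp (\<i> * of_real (k * x)) + R * exp (- \<i> * of_real (k * x)))) \<longlongrightarrow> 0) at_bot) \<and>
        (k < 0 \<longrightarrow>
           ((\<lambda>x. f x - T * exp (\<i> * of_real (k * x))) \<longlongrightarrow> 0) at_bot \<and>
           ((\<lambda>x. f x - (exp (\<i> * of_real (k * x)) + R * exp (- \<i> * of_real (k * x)))) \<longlongrightarrow> 0) at_top))"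

text \<open>The distorted plane wave \<open>e(x, k)\<close>; only meaningful for \<open>k \<noteq> 0\<close>.\<close>

definition ewave :: "nat \<Rightarrow> real \<Rightarrow> real \<Rightarrow> complex" where
  "ewave n x k = (THE f. scattering_solution n k f) x"

text \<open>\<open>P m x z\<close> is \<open>p\<^sub>m(tanh x, z)\<close>; the paper's \<open>P\<^sub>m(x, \<plusminus>ik)\<close> is \<open>z = \<plusminus>\<i> k\<close>.\<close>

primrec P :: "nat \<Rightarrow> real \<Rightarrow> complex \<Rightarrow> complex" where
  "P 0 x z = 1"
| "P (Suc m) x z =
     vector_derivative (\<lambda>y. P m y z) (at x) + (z - of_real (real (Suc m) * tanh x)) * P m x z"

text \<open>Real analyticity in several variables: near every point of \<open>S\<close> the function is the sum of an
  unconditionally convergent power series. Multi-indices are the maps from \<open>Basis\<close> to \<open>nat\<close>,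
  taken extensional so that each one is counted once.\<close>

definition real_analytic_on :: "('a::euclidean_space \<Rightarrow> 'b::banach) \<Rightarrow> 'a set \<Rightarrow> bool"
    (infixl "real'_analytic'_on" 50) where
  "f real_analytic_on S \<longleftrightarrow>
     (\<forall>a\<in>S. \<exists>r>0. \<exists>c :: ('a \<Rightarrow> nat) \<Rightarrow> 'b. \<forall>x\<in>ball a r.
        ((\<lambda>\<alpha>. (\<Prod>b\<in>Basis. ((x - a) \<bullet> b) ^ \<alpha> b) *\<^sub>R c \<alpha>) has_sum f x) (Basis \<rightarrow>\<^sub>E UNIV))"

end

theory Submission
  imports Defs "HOL-Complex_Analysis.Cauchy_Integral_Formula"
begin

text \<open>
  The functions \<open>\<psi>\<^sub>m = P\<^sub>m(x, z) e\<^sup>z\<^sup>x\<close> satisfy \<open>\<psi>\<^sub>m = (d/dx - m tanh x) \<psi>\<^sub>m\<^sub>-\<^sub>1\<close>, and conversely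
  \<open>(d/dx + m tanh x) \<psi>\<^sub>m = (z\<^sup>2 - m\<^sup>2) \<psi>\<^sub>m\<^sub>-\<^sub>1\<close>. Composing the two ladder operators gives the
  Schroedinger equation, and \<open>p\<^sub>m(\<plusminus>1, z) = \<Prod>j (z \<mp> j)\<close> gives the asymptotics; in particular there
  is no reflection. The ladder also yields the Wronskian of \<open>\<psi>\<^sub>n(\<cdot>, z)\<close> and \<open>\<psi>\<^sub>n(\<cdot>, -z)\<close>, namely
  \<open>-2z \<Prod>j (j\<^sup>2 - z\<^sup>2) \<noteq> 0\<close> for \<open>z = ik\<close>, so by Cramer's rule these two functions span all solutions. The
  difference of two scattering solutions is therefore a combination of them, and comparing amplitudes
  at the two ends of the line shows that both coefficients vanish.

  For analyticity it suffices that a series of monomials over any index set whatsoever, once summable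
  near a point, can be regrouped by multi-index. This covers products, holomorphic functions of one
  coordinate, and, after splitting off linear phases, \<open>e\<^sup>i\<^sup>k\<^sup>x\<close>.
\<close>

section \<open>Real analytic functions\<close>

text \<open>Analyticity is a local condition, so the closure properties below are stated at a single
  point \<open>a\<close>.\<close>

lemma real_analytic_on_pointwise: "f real_analytic_on S \<longleftrightarrow> (\<forall>a\<in>S. f real_analytic_on {a})"
  by (simp add: real_analytic_on_def)

lemma real_analytic_at_cong:
  assumes "f real_analytic_on {a}" and "eventually (\<lambda>x. f x = g x) (nhds a)"
  shows "g real_analytic_on {a}"
proof -
  from assms(2) obtain e where e: "e > 0" "\<And>x. x \<in> ball a e \<Longrightarrow> f x = g x"
    unfolding eventually_nhds_metric by (auto simp: dist_commute)
  from assms(1) obtain r c where r: "r > 0"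
    "\<And>x. x \<in> ball a r \<Longrightarrow>
      ((\<lambda>\<alpha>. (\<Prod>b\<in>Basis. ((x - a) \<bullet> b) ^ \<alpha> b) *\<^sub>R c \<alpha>) has_sum f x) (Basis \<rightarrow>\<^sub>E UNIV)"
    unfolding real_analytic_on_def by blast
  have "((\<lambda>\<alpha>. (\<Prod>b\<in>Basis. ((x - a) \<bullet> b) ^ \<alpha> b) *\<^sub>R c \<alpha>) has_sum g x) (Basis \<rightarrow>\<^sub>E UNIV)"
    if "x \<in> ball a (min r e)" for x
    using r(2)[of x] e(2)[of x] that by simp
  then show ?thesis
    unfolding real_analytic_on_def using r(1) e(1)
    by (intro ballI exI[of _ "min r e"] conjI exI[of _ c]) auto
qed

text \<open>Since \<open>\<mu>\<close> may send many indices to the same multi-index, closure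
  properties follow from any convenient expansion. The terms are grouped along the fibres of the
  multi-index map, and each group sums to one coefficient.\<close>

lemma real_analytic_at_monomial_series:
  fixes f :: "'a::euclidean_space \<Rightarrow> 'b::banach" and \<mu> :: "'i \<Rightarrow> 'a \<Rightarrow> nat"
  assumes "r > 0"
    and f: "\<And>x. x \<in> ball a r \<Longrightarrow>
      ((\<lambda>i. (\<Prod>b\<in>Basis. ((x - a) \<bullet> b) ^ \<mu> i b) *\<^sub>R d i) has_sum f x) I"
  shows "f real_analytic_on {a}"
proof -
  \<comment> \<open>Restriction makes the exponents extensional; the monomial only sees their values
    on \<open>Basis\<close>.\<close>
  define \<nu> where "\<nu> i = restrict (\<mu> i) Basis" for i
  define M where "M x \<alpha> = (\<Prod>b\<in>Basis. ((x - a) \<bullet> b) ^ \<alpha> b)" for x and \<alpha> :: "'a \<Rightarrow> nat"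
  define J where "J \<alpha> = {i \<in> I. \<nu> i = \<alpha>}" for \<alpha>
  define c where "c \<alpha> = infsum d (J \<alpha>)" for \<alpha>
  have M: "M x (\<nu> i) = (\<Prod>b\<in>Basis. ((x - a) \<bullet> b) ^ \<mu> i b)" for x i
    unfolding M_def \<nu>_def by (intro prod.cong) auto
  have f': "((\<lambda>i. M x (\<nu> i) *\<^sub>R d i) has_sum f x) I" if "x \<in> ball a r" for x
    using f[OF that] by (simp add: M)
  \<comment> \<open>A point off all coordinate hyperplanes through \<open>a\<close>: there no monomial vanishes, so the
    coefficients themselves are summable over each fibre of \<open>\<nu>\<close>.\<close>
  have "\<exists>y\<in>ball a r. \<forall>b\<in>Basis. (y - a) \<bullet> b \<noteq> 0"
  proof -
    define v where "v = (\<Sum>b\<in>Basis. b :: 'a)"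
    \<comment> \<open>All coordinates of \<open>v\<close> are 1, so those of
      \<open>t *\<^sub>R v\<close> equal \<open>t > 0\<close>. The scale keeps its norm below
      \<open>r\<close>, and the added 1 keeps the denominator positive.\<close>
    define t where "t = r / (2 * (norm v + 1))"
    have v: "v \<bullet> b = 1" if "b \<in> Basis" for b
      unfolding v_def using that by (simp add: inner_sum_left inner_Basis sum.delta)
    have t: "t > 0" using assms(1) unfolding t_def by (simp add: add_nonneg_pos)
    have "t * norm v < t * (2 * (norm v + 1))"
      using t by (intro mult_strict_left_mono) (auto intro: add_nonneg_pos simp: algebra_simps add_strict_increasing)
    also have "\<dots> = r" unfolding t_def using add_nonneg_pos[OF norm_ge_zero[of v] zero_less_one]
      by (simp del: add_nonneg_pos)
    finally have "a + t *\<^sub>R v \<in> ball a r" using t by (simp add: dist_norm)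
    moreover have "\<forall>b\<in>Basis. (a + t *\<^sub>R v - a) \<bullet> b \<noteq> 0" using t v by simp
    ultimately show ?thesis by blast
  qed
  then obtain y where y: "y \<in> ball a r" "\<forall>b\<in>Basis. (y - a) \<bullet> b \<noteq> 0" by blast
  have My: "M y \<alpha> \<noteq> 0" for \<alpha> unfolding M_def using y(2) by simp
  have d: "(d has_sum c \<alpha>) (J \<alpha>)" for \<alpha>
  proof -
    have "(\<lambda>i. M y (\<nu> i) *\<^sub>R d i) summable_on J \<alpha>"
      using f'[OF y(1)] unfolding J_def
      by (intro summable_on_subset_banach[of _ I "{i \<in> I. _ i}"]) (auto simp: summable_on_def)
    then have "(\<lambda>i. M y \<alpha> *\<^sub>R d i) summable_on J \<alpha>"
      by (rule summable_on_cong[THEN iffD1, rotated]) (auto simp: J_def)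
    then have "(\<lambda>i. inverse (M y \<alpha>) *\<^sub>R M y \<alpha> *\<^sub>R d i) summable_on J \<alpha>"
      by (rule summable_on_scaleR_right)
    then have "d summable_on J \<alpha>" using My[of \<alpha>] by simp
    then show ?thesis unfolding c_def by (rule has_sum_infsum)
  qed
  have "((\<lambda>\<alpha>. M x \<alpha> *\<^sub>R c \<alpha>) has_sum f x) (Basis \<rightarrow>\<^sub>E UNIV)" if x: "x \<in> ball a r" for x
  proof -
    \<comment> \<open>Tagging each index with its multi-index turns \<open>I\<close> into the
      disjoint union of the fibres, over which the sum can be iterated.\<close>
    have im: "(\<lambda>i. (\<nu> i, i)) ` I = Sigma (Basis \<rightarrow>\<^sub>E UNIV) J"
      by (auto simp: J_def \<nu>_def)
    have "((\<lambda>(\<alpha>, i). M x \<alpha> *\<^sub>R d i) has_sum f x) ((\<lambda>i. (\<nu> i, i)) ` I)"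
      using f'[OF x] by (subst has_sum_reindex) (auto simp: inj_on_def o_def)
    then have "((\<lambda>(\<alpha>, i). M x \<alpha> *\<^sub>R d i) has_sum f x) (Sigma (Basis \<rightarrow>\<^sub>E UNIV) J)"
      by (simp only: im)
    then show ?thesis
      by (rule has_sum_SigmaD) (simp add: has_sum_scaleR d)
  qed
  then show ?thesis
    unfolding real_analytic_on_def M_def using assms(1) by blast
qed

lemma real_analytic_at_const: "(\<lambda>_. c) real_analytic_on {a}"
  by (rule real_analytic_at_monomial_series[of 1 a "\<lambda>_ _. 0" "\<lambda>_. c" "{()}"])
     (auto intro: has_sum_finiteI)

lemma real_analytic_at_add:
  assumes "f real_analytic_on {a}" "g real_analytic_on {a}"
  shows "(\<lambda>x. f x + g x) real_analytic_on {a}"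
proof -
  from assms(1) obtain r c where r: "r > 0"
    "\<And>x. x \<in> ball a r \<Longrightarrow>
      ((\<lambda>\<alpha>. (\<Prod>b\<in>Basis. ((x - a) \<bullet> b) ^ \<alpha> b) *\<^sub>R c \<alpha>) has_sum f x) (Basis \<rightarrow>\<^sub>E UNIV)"
    unfolding real_analytic_on_def by blast
  from assms(2) obtain s d where s: "s > 0"
    "\<And>x. x \<in> ball a s \<Longrightarrow>
      ((\<lambda>\<alpha>. (\<Prod>b\<in>Basis. ((x - a) \<bullet> b) ^ \<alpha> b) *\<^sub>R d \<alpha>) has_sum g x) (Basis \<rightarrow>\<^sub>E UNIV)"
    unfolding real_analytic_on_def by blast
  have "((\<lambda>\<alpha>. (\<Prod>b\<in>Basis. ((x - a) \<bullet> b) ^ \<alpha> b) *\<^sub>R (c \<alpha> + d \<alpha>)) has_sum (f x + g x)) (Basis \<rightarrow>\<^sub>E UNIV)"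
    if "x \<in> ball a (min r s)" for x
    using has_sum_add[OF r(2)[of x] s(2)[of x]] that by (simp add: scaleR_add_right)
  then show ?thesis
    unfolding real_analytic_on_def using r(1) s(1)
    by (intro ballI exI[of _ "min r s"] conjI exI[of _ "\<lambda>\<alpha>. c \<alpha> + d \<alpha>"]) auto
qed

text \<open>For complex series unconditional and absolute summability agree, and absolute
  summability passes to the product index set. The value then comes from the iterated sum.\<close>

lemma has_sum_Times_mult:
  fixes f :: "'i \<Rightarrow> complex" and g :: "'j \<Rightarrow> complex"
  assumes f: "(f has_sum s) I" and g: "(g has_sum t) J"
  shows "((\<lambda>(i, j). f i * g j) has_sum (s * t)) (I \<times> J)"
proof (rule has_sum_SigmaI)
  show "((\<lambda>j. case (i, j) of (i, j) \<Rightarrow> f i * g j) has_sum (f i * t)) J" for i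
    using has_sum_cmult_right[OF g] by simp
  show "((\<lambda>i. f i * t) has_sum (s * t)) I"
    using has_sum_cmult_left[OF f] by simp
  have "(\<lambda>i. norm (f i)) summable_on I" "(\<lambda>j. norm (g j)) summable_on J"
    using f g has_sum_imp_summable by (auto simp flip: summable_on_iff_abs_summable_on_complex)
  then have "(\<lambda>p. norm ((\<lambda>(i, j). f i * g j) p)) summable_on (I \<times> J)"
    by (subst Infinite_Sum.abs_summable_on_Sigma_iff)
       (auto simp: norm_mult infsum_cmult_right' abs_mult infsum_nonneg
         intro!: summable_on_cmult_right summable_on_cmult_left)
  then show "(\<lambda>(i, j). f i * g j) summable_on (I \<times> J)"
    by (simp add: summable_on_iff_abs_summable_on_complex)
qed

text \<open>The product is a series over pairs of multi-indices in which exponents add; regrouping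
  replaces an explicit Cauchy product.\<close>

lemma real_analytic_at_mult:
  fixes f g :: "'a::euclidean_space \<Rightarrow> complex"
  assumes "f real_analytic_on {a}" "g real_analytic_on {a}"
  shows "(\<lambda>x. f x * g x) real_analytic_on {a}"
proof -
  from assms(1) obtain r c where r: "r > 0"
    "\<And>x. x \<in> ball a r \<Longrightarrow>
      ((\<lambda>\<alpha>. (\<Prod>b\<in>Basis. ((x - a) \<bullet> b) ^ \<alpha> b) *\<^sub>R c \<alpha>) has_sum f x) (Basis \<rightarrow>\<^sub>E UNIV)"
    unfolding real_analytic_on_def by blast
  from assms(2) obtain s d where s: "s > 0"
    "\<And>x. x \<in> ball a s \<Longrightarrow>
      ((\<lambda>\<alpha>. (\<Prod>b\<in>Basis. ((x - a) \<bullet> b) ^ \<alpha> b) *\<^sub>R d \<alpha>) has_sum g x) (Basis \<rightarrow>\<^sub>E UNIV)"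
    unfolding real_analytic_on_def by blast
  show ?thesis
  proof (rule real_analytic_at_monomial_series)
    show "min r s > 0" using r(1) s(1) by simp
    fix x assume x: "x \<in> ball a (min r s)"
    show "((\<lambda>p. (\<Prod>b\<in>Basis. ((x - a) \<bullet> b) ^ (fst p b + snd p b)) *\<^sub>R (c (fst p) * d (snd p)))
      has_sum f x * g x) ((Basis \<rightarrow>\<^sub>E UNIV) \<times> (Basis \<rightarrow>\<^sub>E UNIV))"
      using has_sum_Times_mult[OF r(2) s(2)] x
      by (simp add: case_prod_unfold power_add prod.distrib mult_ac)
  qed
qed

lemma real_analytic_at_sum:
  assumes "\<And>i. i \<in> I \<Longrightarrow> f i real_analytic_on {a}"
  shows "(\<lambda>x. \<Sum>i\<in>I. f i x) real_analytic_on {a}"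
  using assms
  by (induction I rule: infinite_finite_induct)
     (auto intro: real_analytic_at_const real_analytic_at_add)

lemma real_analytic_at_power:
  fixes f :: "'a::euclidean_space \<Rightarrow> complex"
  assumes "f real_analytic_on {a}"
  shows "(\<lambda>x. f x ^ m) real_analytic_on {a}"
  using assms by (induction m) (auto intro: real_analytic_at_const real_analytic_at_mult)

lemma real_analytic_at_diff:
  fixes f g :: "'a::euclidean_space \<Rightarrow> complex"
  assumes "f real_analytic_on {a}" "g real_analytic_on {a}"
  shows "(\<lambda>x. f x - g x) real_analytic_on {a}"
  using real_analytic_at_add[OF assms(1) real_analytic_at_mult[OF real_analytic_at_const[of "-1"] assms(2)]]
  by simp

section \<open>Analyticity from holomorphic functions and bilinear phases\<close>

text \<open>A Taylor series converges absolutely at \<open>w\<close> because it converges at a point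
  farther from the centre; this upgrades ordered to unconditional convergence.\<close>

lemma has_sum_power_series:
  fixes g :: "complex \<Rightarrow> complex"
  assumes g: "g holomorphic_on ball z r" and w: "w \<in> ball z r"
  shows "((\<lambda>m. (deriv ^^ m) g z / fact m * (w - z) ^ m) has_sum g w) UNIV"
proof (rule norm_summable_imp_has_sum)
  show "(\<lambda>m. (deriv ^^ m) g z / fact m * (w - z) ^ m) sums g w"
    by (rule holomorphic_power_series[OF g w])
  \<comment> \<open>The midpoint between \<open>norm (w - z)\<close> and \<open>r\<close>: still
    inside the disc, but strictly beyond \<open>w\<close>.\<close>
  define \<rho> where "\<rho> = (norm (w - z) + r) / 2"
  have \<rho>: "norm (w - z) < \<rho>" "\<rho> < r" "\<rho> > 0"
    using w by (auto simp: \<rho>_def dist_norm norm_minus_commute)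
       (smt (verit) norm_ge_zero half_gt_zero)
  have "z + of_real \<rho> \<in> ball z r" using \<rho> by (simp add: dist_norm)
  from holomorphic_power_series[OF g this]
  have "summable (\<lambda>m. (deriv ^^ m) g z / fact m * of_real \<rho> ^ m)"
    by (simp add: sums_iff)
  then show "summable (\<lambda>m. norm ((deriv ^^ m) g z / fact m * (w - z) ^ m))"
    by (rule powser_insidea) (use \<rho> in simp)
qed

text \<open>The Taylor series of \<open>g\<close> is a monomial series whose multi-indices are
  supported at \<open>e\<close>.\<close>

lemma real_analytic_at_holomorphic_coordinate:
  fixes a :: "'a::euclidean_space"
  assumes g: "g holomorphic_on S" "open S" "of_real (a \<bullet> e) \<in> S" and e: "e \<in> Basis"
  shows "(\<lambda>x. g (of_real (x \<bullet> e))) real_analytic_on {a}"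
proof -
  from g obtain r where r: "r > 0" "ball (of_real (a \<bullet> e)) r \<subseteq> S"
    using open_contains_ball by blast
  have h: "g holomorphic_on ball (of_real (a \<bullet> e)) r"
    using g(1) r(2) by (rule holomorphic_on_subset)
  show ?thesis
  proof (rule real_analytic_at_monomial_series[OF r(1)])
    fix x assume "x \<in> ball a r"
    then have "\<bar>(x - a) \<bullet> e\<bar> < r"
      using Basis_le_norm[OF e, of "x - a"] by (simp add: dist_norm norm_minus_commute)
    then have "complex_of_real (x \<bullet> e) \<in> ball (of_real (a \<bullet> e)) r"
      by (simp add: dist_norm norm_minus_commute inner_diff_left flip: of_real_diff)
    from has_sum_power_series[OF h this]
    show "((\<lambda>m. (\<Prod>b\<in>Basis. ((x - a) \<bullet> b) ^ (if b = e then m else 0)) *\<^sub>R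
        ((deriv ^^ m) g (of_real (a \<bullet> e)) / fact m)) has_sum g (of_real (x \<bullet> e))) UNIV"
      using e by (simp add: if_distrib[of "\<lambda>m. _ ^ m"] inner_diff_left scaleR_conv_of_real mult_ac
          cong: if_cong)
  qed
qed

text \<open>With \<open>s\<close>, \<open>t\<close> the coordinates of \<open>a\<close>, the
  identity \<open>x y = (x - s) (y - t) + t x + s y - s t\<close> splits the exponential into a
  centred bilinear factor, two factors in one coordinate each, and a constant.\<close>

lemma real_analytic_at_exp_bilinear:
  fixes a :: "'a::euclidean_space" and c :: complex
  assumes e: "e \<in> Basis" "e' \<in> Basis" "e \<noteq> e'"
  shows "(\<lambda>x. exp (c * of_real (x \<bullet> e) * of_real (x \<bullet> e'))) real_analytic_on {a}"
proof -
  define s t where "s = complex_of_real (a \<bullet> e)" and "t = complex_of_real (a \<bullet> e')"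
  have 1: "(\<lambda>x. exp (c * of_real ((x - a) \<bullet> e) * of_real ((x - a) \<bullet> e'))) real_analytic_on {a}"
  \<comment> \<open>The exponential series only involves multi-indices with equal exponents at
    \<open>e\<close> and \<open>e'\<close>. It converges everywhere, so the radius 1 is
    arbitrary.\<close>
  proof (rule real_analytic_at_monomial_series[OF zero_less_one])
    fix x :: 'a
    define w where "w = c * of_real ((x - a) \<bullet> e) * of_real ((x - a) \<bullet> e')"
    have "((\<lambda>m. w ^ m /\<^sub>R fact m) has_sum exp w) UNIV"
      by (intro norm_summable_imp_has_sum summable_norm_exp exp_converges)
    moreover have "(\<Prod>b\<in>Basis. ((x - a) \<bullet> b) ^ (if b \<in> {e, e'} then m else 0)) =
        ((x - a) \<bullet> e) ^ m * ((x - a) \<bullet> e') ^ m" for m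
    proof -
      have "(\<Prod>b\<in>Basis. ((x - a) \<bullet> b) ^ (if b \<in> {e, e'} then m else 0)) =
          (\<Prod>b\<in>{e, e'}. ((x - a) \<bullet> b) ^ m)"
        using e by (intro prod.mono_neutral_cong_right) auto
      then show ?thesis using e by simp
    qed
    ultimately show "((\<lambda>m. (\<Prod>b\<in>Basis. ((x - a) \<bullet> b) ^ (if b \<in> {e, e'} then m else 0)) *\<^sub>R
        (c ^ m / fact m)) has_sum exp (c * of_real ((x - a) \<bullet> e) * of_real ((x - a) \<bullet> e'))) UNIV"
      by (simp add: w_def power_mult_distrib scaleR_conv_of_real divide_inverse mult_ac)
  qed
  have 2: "(\<lambda>x. exp (c * t * of_real (x \<bullet> e))) real_analytic_on {a}"
    "(\<lambda>x. exp (c * s * of_real (x \<bullet> e'))) real_analytic_on {a}"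
    using e by (auto intro!: real_analytic_at_holomorphic_coordinate[of _ UNIV] holomorphic_intros)
  have "exp (c * of_real ((x - a) \<bullet> e) * of_real ((x - a) \<bullet> e')) *
      (exp (c * t * of_real (x \<bullet> e)) * (exp (c * s * of_real (x \<bullet> e')) * exp (- c * s * t))) =
      exp (c * of_real (x \<bullet> e) * of_real (x \<bullet> e'))" for x
    by (simp add: s_def t_def inner_diff_left algebra_simps flip: exp_add)
  then show ?thesis
    using real_analytic_at_mult[OF 1 real_analytic_at_mult[OF 2(1)
        real_analytic_at_mult[OF 2(2) real_analytic_at_const[of "exp (- c * s * t)"]]]]
    by simp
qed

section \<open>Ladder operators\<close>

text \<open>This is \<open>p\<^sub>m\<close> as a polynomial in \<open>t = tanh x\<close>: there
  \<open>d/dx\<close> becomes \<open>(1 - t\<^sup>2) d/dt\<close>, which explains the factor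
  \<open>[:1, 0, -1:]\<close>.\<close>

primrec ladder_poly :: "nat \<Rightarrow> complex \<Rightarrow> complex poly" where
  "ladder_poly 0 z = 1"
| "ladder_poly (Suc m) z =
     [:1, 0, -1:] * pderiv (ladder_poly m z) + [:z, - of_nat (Suc m):] * ladder_poly m z"

lemma has_vector_derivative_poly_tanh:
  fixes q :: "complex poly"
  shows "((\<lambda>y. poly q (of_real (tanh y))) has_vector_derivative
    (1 - (of_real (tanh x))\<^sup>2) * poly (pderiv q) (of_real (tanh x))) (at x)"
proof -
  have "((\<lambda>y. complex_of_real (tanh y)) has_vector_derivative of_real (1 - (tanh x)\<^sup>2)) (at x)"
    by (auto intro!: derivative_eq_intros)
  from field_vector_diff_chain_at[OF this poly_DERIV[of q]] show ?thesis
    by (simp add: o_def)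
qed

lemma P_eq_ladder_poly: "P m x z = poly (ladder_poly m z) (of_real (tanh x))"
proof (induction m arbitrary: x)
  case (Suc m)
  have "vector_derivative (\<lambda>y. P m y z) (at x) =
      (1 - (of_real (tanh x))\<^sup>2) * poly (pderiv (ladder_poly m z)) (of_real (tanh x))"
    by (simp add: Suc vector_derivative_at[OF has_vector_derivative_poly_tanh])
  then show ?case by (simp add: Suc algebra_simps power2_eq_square)
qed simp

text \<open>The polynomial form supplies differentiability, so that the
  \<open>vector_derivative\<close> in the recursion is a genuine derivative and the recursion can be
  solved for it.\<close>

lemma has_vector_derivative_P:
  "((\<lambda>y. P m y z) has_vector_derivative
    (P (Suc m) x z - (z - of_real (real (Suc m) * tanh x)) * P m x z)) (at x)"
proof -
  have "(\<lambda>y. P m y z) differentiable at x"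
    using has_vector_derivative_poly_tanh[of "ladder_poly m z" x]
    by (auto simp: P_eq_ladder_poly intro: differentiableI_vector)
  then show ?thesis by (simp add: vector_derivative_works)
qed

text \<open>This bound allows an expansion in powers of \<open>tanh x\<close> whose index range is
  independent of \<open>z\<close>.\<close>

lemma degree_ladder_poly: "degree (ladder_poly m z) \<le> m"
proof (induction m)
  case (Suc m)
  have "degree ([:1, 0, -1:] * pderiv (ladder_poly m z)) \<le> Suc m"
  proof (cases "m = 0")
    case False
    have "degree ([:1, 0, -1:] * pderiv (ladder_poly m z)) \<le> 2 + (m - 1)"
      using Suc by (intro order.trans[OF degree_mult_le] add_mono) (auto simp: degree_pderiv)
    then show ?thesis using False by simp
  qed simp
  moreover have "degree ([:z, - of_nat (Suc m):] * ladder_poly m z) \<le> 1 + m"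
    using Suc by (intro order.trans[OF degree_mult_le] add_mono) auto
  ultimately show ?case by (auto intro: degree_add_le)
qed simp

text \<open>At \<open>t = 1\<close>, as at \<open>t = -1\<close> below, the factor
  \<open>1 - t\<^sup>2\<close> removes the derivative term and the recursion becomes a plain
  product.\<close>

lemma poly_ladder_poly_1: "poly (ladder_poly m z) 1 = (\<Prod>j=1..m. z - of_nat j)"
  by (induction m) (simp_all add: algebra_simps)

lemma poly_ladder_poly_minus_1: "poly (ladder_poly m z) (- 1) = (\<Prod>j=1..m. z + of_nat j)"
  by (induction m) (simp_all add: algebra_simps)

text \<open>Changing the signs of both \<open>t\<close> and \<open>z\<close> reverses the derivative
  term and the linear factor, so each recursion step contributes one sign.\<close>

lemma ladder_poly_reflect: "pcompose (ladder_poly m (- z)) [:0, -1:] = (- 1) ^ m * ladder_poly m z"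
proof (induction m)
  case (Suc m)
  let ?q = "ladder_poly m (- z)"
  have "pcompose (pderiv ?q) [:0, -1:] = - pderiv (pcompose ?q [:0, -1:])"
    by (simp add: pderiv_pcompose pderiv_pCons)
  also have "pderiv (pcompose ?q [:0, -1:]) = (- 1) ^ m * pderiv (ladder_poly m z)"
    by (cases "even m") (simp_all add: Suc pderiv_minus)
  finally have 1: "pcompose (pderiv ?q) [:0, -1:] = - ((- 1) ^ m * pderiv (ladder_poly m z))" .
  have 2: "pcompose [:1, 0, -1:] [:0, -1:] = [:1, 0, -1 :: complex:]"
    "pcompose [:- z, - of_nat (Suc m):] [:0, -1:] = - [:z, - of_nat (Suc m):]"
    by (simp_all add: pcompose_pCons)
  show ?case
    unfolding ladder_poly.simps pcompose_add pcompose_mult 1 2 Suc by (simp only: power_Suc) algebra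
qed (simp add: pcompose_1)

lemma P_minus: "P m (- x) z = (- 1) ^ m * P m x (- z)"
proof -
  have "P m (- x) z = poly (pcompose (ladder_poly m (- (- z))) [:0, -1:]) (of_real (tanh x))"
    by (simp add: P_eq_ladder_poly poly_pcompose)
  also have "\<dots> = (- 1) ^ m * P m x (- z)"
    unfolding ladder_poly_reflect by (simp add: P_eq_ladder_poly)
  finally show ?thesis .
qed

text \<open>Apart from \<open>z\<close>, the recursion has real coefficients, and
  \<open>tanh x\<close> is real.\<close>

lemma cnj_P: "cnj (P m x z) = P m x (cnj z)"
proof -
  have "map_poly cnj (ladder_poly m z) = ladder_poly m (cnj z)"
  proof (induction m)
    case (Suc m)
    have "cnj (coeff (ladder_poly m z) i) = coeff (ladder_poly m (cnj z)) i" for i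
      using arg_cong[OF Suc, of "\<lambda>p. coeff p i"] by (simp add: coeff_map_poly)
    then show ?case
      by (intro poly_eqI) (simp add: coeff_map_poly coeff_pderiv coeff_pCons split: nat.splits)
  qed simp
  then show ?thesis
    using poly_cnj[of "ladder_poly m z" "of_real (tanh x)"] by (simp add: P_eq_ladder_poly)
qed

section \<open>The functions \<open>\<psi>\<^sub>m\<close> and their differential equations\<close>

definition ladder_wave :: "nat \<Rightarrow> complex \<Rightarrow> real \<Rightarrow> complex" where
  "ladder_wave m z x = P m x z * exp (z * of_real x)"

lemma has_vector_derivative_exp_of_real:
  fixes z :: complex
  shows "((\<lambda>x. exp (z * of_real x)) has_vector_derivative z * exp (z * of_real x)) (at x)"
  by (rule has_vector_derivative_real_field) (auto intro!: derivative_eq_intros)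

lemma has_vector_derivative_tanh:
  "((\<lambda>x. complex_of_real (tanh x)) has_vector_derivative 1 - (of_real (tanh x))\<^sup>2) (at x)"
  by (auto intro!: derivative_eq_intros)

text \<open>Differentiating the exponential yields \<open>z * P m x z\<close>, which cancels against
  the \<open>z\<close> in the recursion.\<close>

lemma ladder_wave_raise:
  "(ladder_wave m z has_vector_derivative
    ladder_wave (Suc m) z x + of_nat (Suc m) * of_real (tanh x) * ladder_wave m z x) (at x)"
proof -
  have "(ladder_wave m z has_vector_derivative
      P m x z * (z * exp (z * of_real x)) +
      (P (Suc m) x z - (z - of_real (real (Suc m) * tanh x)) * P m x z) * exp (z * of_real x)) (at x)"
    unfolding ladder_wave_def
    by (intro has_vector_derivative_mult has_vector_derivative_P has_vector_derivative_exp_of_real)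
  then show ?thesis
    by (rule has_vector_derivative_eq_rhs) (simp add: ladder_wave_def algebra_simps del: P.simps)
qed

text \<open>The induction passes through a three-term relation that writes
  \<open>\<psi>\<^sub>m\<^sub>+\<^sub>2\<close> in terms of \<open>\<psi>\<^sub>m\<close> and
  \<open>\<psi>\<^sub>m\<^sub>+\<^sub>1\<close>, whose derivatives are known from raising and from
  the induction hypothesis.\<close>

lemma ladder_wave_lower:
  "(ladder_wave (Suc m) z has_vector_derivative
    (z\<^sup>2 - (of_nat (Suc m))\<^sup>2) * ladder_wave m z x
      - of_nat (Suc m) * of_real (tanh x) * ladder_wave (Suc m) z x) (at x)"
proof (induction m arbitrary: x)
  case 0
  have *: "ladder_wave (Suc 0) z = (\<lambda>x. (z - of_real (tanh x)) * exp (z * of_real x))"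
    by (simp add: ladder_wave_def fun_eq_iff)
  show ?case unfolding *
    by (rule has_vector_derivative_eq_rhs, (rule has_vector_derivative_mult has_vector_derivative_diff
      has_vector_derivative_const has_vector_derivative_tanh has_vector_derivative_exp_of_real)+)
      (simp add: ladder_wave_def algebra_simps power2_eq_square)
next
  case (Suc m)
  let ?t = "\<lambda>x. complex_of_real (tanh x)"
  let ?w = "\<lambda>m. ladder_wave m z"
  \<comment> \<open>Lowering (induction hypothesis) and raising give two expressions for the
    derivative of \<open>?w (Suc m)\<close>; equating them yields
    \<open>2 m + 3 = (m + 1) + (m + 2)\<close>.\<close>
  have three_term: "?w (Suc (Suc m)) x =
      (z\<^sup>2 - (of_nat (Suc m))\<^sup>2) * ?w m x - (2 * of_nat m + 3) * (?t x * ?w (Suc m) x)" for x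
    using vector_derivative_unique_at[OF Suc ladder_wave_raise[of "Suc m" z x]]
    by (simp add: algebra_simps)
  have "(?w (Suc (Suc m)) has_vector_derivative
      (z\<^sup>2 - (of_nat (Suc m))\<^sup>2) * (?w (Suc m) x + of_nat (Suc m) * ?t x * ?w m x)
      - (2 * of_nat m + 3) *
        (?t x * ((z\<^sup>2 - (of_nat (Suc m))\<^sup>2) * ?w m x - of_nat (Suc m) * ?t x * ?w (Suc m) x)
          + (1 - (?t x)\<^sup>2) * ?w (Suc m) x)) (at x)"
    unfolding three_term[abs_def]
    by (intro has_vector_derivative_diff has_vector_derivative_mult_right has_vector_derivative_mult
        ladder_wave_raise has_vector_derivative_tanh Suc)
  then show ?case
    by (rule has_vector_derivative_eq_rhs) (simp add: three_term, algebra)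
qed

lemma ladder_wave_three_term:
  "ladder_wave (Suc (Suc m)) z x = (z\<^sup>2 - (of_nat (Suc m))\<^sup>2) * ladder_wave m z x
     - (2 * of_nat m + 3) * (of_real (tanh x) * ladder_wave (Suc m) z x)"
  using vector_derivative_unique_at[OF ladder_wave_lower[of m z x] ladder_wave_raise[of "Suc m" z x]]
  by (simp add: algebra_simps)

text \<open>The function being differentiated is the derivative of \<open>\<psi>\<^sub>m\<close> by
  \<open>ladder_wave_raise\<close>, so this is the Schroedinger equation; lowering at
  \<open>m + 1\<close> is composed with raising at \<open>m\<close>.\<close>

lemma has_vector_derivative_deriv_ladder_wave:
  "((\<lambda>x. ladder_wave (Suc m) z x + of_nat (Suc m) * of_real (tanh x) * ladder_wave m z x)
    has_vector_derivative
    (z\<^sup>2 - of_nat m * (of_nat m + 1) * (1 - (of_real (tanh x))\<^sup>2)) * ladder_wave m z x) (at x)"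
  unfolding mult.assoc
  by (rule has_vector_derivative_eq_rhs, (rule has_vector_derivative_add ladder_wave_lower
    has_vector_derivative_mult_right has_vector_derivative_mult ladder_wave_raise has_vector_derivative_tanh)+)
   (simp, algebra)

lemma V_eq: "V n x = - (real n * (real n + 1)) * (1 - (tanh x)\<^sup>2)"
proof -
  have "(1 / cosh x)\<^sup>2 = 1 - (tanh x)\<^sup>2"
    using hyperbolic_pythagoras[of x]
    by (simp add: tanh_def power_divide eq_divide_eq divide_eq_eq left_diff_distrib)
  then show ?thesis by (simp add: V_def)
qed

lemma schroedinger_solution_ladder_wave:
  assumes "z\<^sup>2 = - of_real (k\<^sup>2)"
  shows "schroedinger_solution n k (\<lambda>x. c * ladder_wave n z x)"
proof -
  have "((\<lambda>x. c * ladder_wave n z x) has_vector_derivative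
      c * (ladder_wave (Suc n) z x + of_nat (Suc n) * of_real (tanh x) * ladder_wave n z x)) (at x)" for x
    by (intro has_vector_derivative_mult_right ladder_wave_raise)
  moreover have "((\<lambda>x. c * (ladder_wave (Suc n) z x + of_nat (Suc n) * of_real (tanh x) * ladder_wave n z x))
      has_vector_derivative
      c * ((z\<^sup>2 - of_nat n * (of_nat n + 1) * (1 - (of_real (tanh x))\<^sup>2)) * ladder_wave n z x)) (at x)" for x
    by (intro has_vector_derivative_mult_right has_vector_derivative_deriv_ladder_wave)
  ultimately show ?thesis
    unfolding schroedinger_solution_def assms
    by (intro exI allI conjI) (assumption, assumption, simp add: V_eq algebra_simps)
qed

text \<open>This is the Wronskian in disguise: by \<open>ladder_wave_raise\<close> the derivatives
  differ from the waves at level \<open>m + 1\<close> by tanh terms that cancel. In the three-term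
  relation the tanh terms cancel too, so each level multiplies the value by
  \<open>(m + 1)\<^sup>2 - z\<^sup>2\<close>.\<close>

lemma ladder_wave_wronskian:
  "ladder_wave m z x * ladder_wave (Suc m) (- z) x - ladder_wave (Suc m) z x * ladder_wave m (- z) x =
     - 2 * z * (\<Prod>j=1..m. (of_nat j)\<^sup>2 - z\<^sup>2)"
proof (induction m)
  case 0
  show ?case by (simp add: ladder_wave_def algebra_simps flip: exp_add)
next
  case (Suc m)
  have "ladder_wave (Suc m) z x * ladder_wave (Suc (Suc m)) (- z) x
      - ladder_wave (Suc (Suc m)) z x * ladder_wave (Suc m) (- z) x =
      ((of_nat (Suc m))\<^sup>2 - z\<^sup>2) * (ladder_wave m z x * ladder_wave (Suc m) (- z) x
        - ladder_wave (Suc m) z x * ladder_wave m (- z) x)"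
    unfolding ladder_wave_three_term by (simp add: algebra_simps)
  then show ?case unfolding Suc by simp
qed

section \<open>Wronskians and the solution space\<close>

lemma wronskian_constant:
  fixes f g q :: "real \<Rightarrow> complex"
  assumes "\<And>x. (f has_vector_derivative f' x) (at x)" "\<And>x. (f' has_vector_derivative q x * f x) (at x)"
    and "\<And>x. (g has_vector_derivative g' x) (at x)" "\<And>x. (g' has_vector_derivative q x * g x) (at x)"
  obtains c where "\<And>x. f x * g' x - f' x * g x = c"
proof -
  have "((\<lambda>x. f x * g' x - f' x * g x) has_vector_derivative 0) (at x)" for x
    by (rule has_vector_derivative_eq_rhs,
        (rule has_vector_derivative_diff has_vector_derivative_mult assms)+) (simp add: algebra_simps)
  then show ?thesis
    using has_vector_derivative_zero_constant[of UNIV "\<lambda>x. f x * g' x - f' x * g x"] that by auto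
qed

lemma schroedinger_solution_diff:
  assumes "schroedinger_solution n k f" "schroedinger_solution n k g"
  shows "schroedinger_solution n k (\<lambda>x. f x - g x)"
proof -
  obtain f' f'' g' g'' where
    f: "\<And>x. (f has_vector_derivative f' x) (at x) \<and> (f' has_vector_derivative f'' x) (at x) \<and>
       - f'' x + of_real (V n x) * f x = of_real (k\<^sup>2) * f x" and
    g: "\<And>x. (g has_vector_derivative g' x) (at x) \<and> (g' has_vector_derivative g'' x) (at x) \<and>
       - g'' x + of_real (V n x) * g x = of_real (k\<^sup>2) * g x"
    using assms unfolding schroedinger_solution_def by blast
  have "- (f'' x - g'' x) + of_real (V n x) * (f x - g x) = of_real (k\<^sup>2) * (f x - g x)" for x
    using f[of x] g[of x] by (simp add: algebra_simps)
  with f g show ?thesis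
    unfolding schroedinger_solution_def
    by (intro exI[of _ "\<lambda>x. f' x - g' x"] exI[of _ "\<lambda>x. f'' x - g'' x"])
       (auto intro: has_vector_derivative_diff)
qed

text \<open>The coefficients are constant Wronskians of \<open>h\<close> with the two waves, divided
  by the nonzero Wronskian of the waves themselves.\<close>

lemma schroedinger_solution_span:
  assumes sol: "schroedinger_solution n k h" and k: "k \<noteq> 0"
  obtains a b where "\<And>x. h x = a * ladder_wave n (\<i> * of_real k) x + b * ladder_wave n (- (\<i> * of_real k)) x"
proof -
  define z where "z = \<i> * complex_of_real k"
  define q where "q x = z\<^sup>2 - of_nat n * (of_nat n + 1) * (1 - (complex_of_real (tanh x))\<^sup>2)" for x
  \<comment> \<open>\<open>w \<zeta>\<close> is the derivative of
    \<open>ladder_wave n \<zeta>\<close>.\<close>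
  define w where "w \<zeta> x = ladder_wave (Suc n) \<zeta> x + of_nat (Suc n) * of_real (tanh x) * ladder_wave n \<zeta> x" for \<zeta> x
  obtain h' h'' where h: "\<And>x. (h has_vector_derivative h' x) (at x)"
    "\<And>x. (h' has_vector_derivative h'' x) (at x)"
    "\<And>x. - h'' x + of_real (V n x) * h x = of_real (k\<^sup>2) * h x"
    using sol unfolding schroedinger_solution_def by blast
  have "h'' x = q x * h x" for x
    using h(3)[of x] by (simp add: q_def z_def V_eq power_mult_distrib algebra_simps)
  with h(2) have h': "(h' has_vector_derivative q x * h x) (at x)" for x by metis
  have w: "(ladder_wave n \<zeta> has_vector_derivative w \<zeta> x) (at x)"
    "(w \<zeta> has_vector_derivative q x * ladder_wave n \<zeta> x) (at x)" if "\<zeta>\<^sup>2 = z\<^sup>2" for x \<zeta>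
    using ladder_wave_raise[of n \<zeta> x] has_vector_derivative_deriv_ladder_wave[of n \<zeta> x] that
    unfolding w_def[abs_def] q_def by auto
  obtain \<alpha> where \<alpha>: "\<And>x. h x * w (- z) x - h' x * ladder_wave n (- z) x = \<alpha>"
    by (rule wronskian_constant[OF h(1) h' w[of "- z"]]) auto
  obtain \<beta> where \<beta>: "\<And>x. h x * w z x - h' x * ladder_wave n z x = \<beta>"
    by (rule wronskian_constant[OF h(1) h' w[of z]]) auto
  define \<omega> where "\<omega> = - 2 * z * (\<Prod>j=1..n. (of_nat j)\<^sup>2 - z\<^sup>2)"
  have \<omega>: "ladder_wave n z x * w (- z) x - w z x * ladder_wave n (- z) x = \<omega>" for x
    using ladder_wave_wronskian[of n z x] by (simp add: w_def \<omega>_def algebra_simps)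
  \<comment> \<open>For \<open>z = \<i> k\<close> each factor of \<open>\<omega>\<close> is the
    positive number \<open>j\<^sup>2 + k\<^sup>2\<close>.\<close>
  have "(of_nat j)\<^sup>2 - z\<^sup>2 \<noteq> 0" for j
  proof -
    have "(of_nat j)\<^sup>2 - z\<^sup>2 = complex_of_real ((real j)\<^sup>2 + k\<^sup>2)"
      by (simp add: z_def power_mult_distrib)
    also have "\<dots> \<noteq> 0" using k by (simp add: sum_power2_eq_zero_iff del: of_real_add)
    finally show ?thesis .
  qed
  then have nz: "\<omega> \<noteq> 0" using k by (simp add: \<omega>_def z_def)
  \<comment> \<open>Cramer's rule\<close>
  have "h x * \<omega> = \<alpha> * ladder_wave n z x - \<beta> * ladder_wave n (- z) x" for x
    unfolding \<omega>[of x, symmetric] \<alpha>[of x, symmetric] \<beta>[of x, symmetric] by (simp add: algebra_simps)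
  then have "h x = \<alpha> / \<omega> * ladder_wave n z x + (- \<beta> / \<omega>) * ladder_wave n (- z) x" for x
    using nz by (simp add: field_simps)
  then show ?thesis using that unfolding z_def by blast
qed

section \<open>Amplitudes at the two ends of the line\<close>

text \<open>A shift by a signed quarter period multiplies the two exponentials by
  \<open>\<i>\<close> and \<open>- \<i>\<close>. Hence \<open>f x - \<i> * f (x + c)\<close> and
  \<open>f x + \<i> * f (x + c)\<close> each isolate one of them, with constant modulus
  \<open>2 * norm a\<close> or \<open>2 * norm b\<close>.\<close>

lemma tendsto_oscillation_zeroD:
  fixes a b :: complex and k :: real
  assumes lim: "((\<lambda>x. a * exp (\<i> * of_real k * of_real x) + b * exp (- (\<i> * of_real k) * of_real x)) \<longlongrightarrow> 0) F"
    and k: "k \<noteq> 0" and F: "F = at_top \<or> F = at_bot"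
  shows "a = 0" "b = 0"
proof -
  define f where "f x = a * exp (\<i> * of_real k * of_real x) + b * exp (- (\<i> * of_real k) * of_real x)" for x :: real
  define c where "c = pi / (2 * k)"
  have nF: "F \<noteq> bot"
    by (rule disjE[OF F]) simp_all
  have "filterlim (\<lambda>x. x + c) F F"
    using F by (auto simp: add.commute[of _ c] filterlim_ident
        filterlim_tendsto_add_at_top_iff[OF tendsto_const] filterlim_tendsto_add_at_bot_iff[OF tendsto_const])
  with lim have lim': "((\<lambda>x. f (x + c)) \<longlongrightarrow> 0) F"
    unfolding f_def[symmetric] by (rule filterlim_compose)
  have kc: "\<i> * complex_of_real k * of_real c = \<i> * of_real (pi / 2)"
    using k by (simp add: c_def field_simps)
  have e: "exp (\<i> * of_real k * of_real c) = \<i>" "exp (- (\<i> * of_real k * of_real c)) = - \<i>"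
    unfolding exp_minus kc cis_conv_exp[symmetric] by simp_all
  have shift: "f (x + c) = \<i> * (a * exp (\<i> * of_real k * of_real x) - b * exp (- (\<i> * of_real k) * of_real x))" for x
  proof -
    have "f (x + c) = a * (exp (\<i> * of_real k * of_real x) * exp (\<i> * of_real k * of_real c))
      + b * (exp (- (\<i> * of_real k) * of_real x) * exp (- (\<i> * of_real k * of_real c)))"
      unfolding f_def by (simp add: distrib_left flip: exp_add)
    then show ?thesis unfolding e by (simp add: algebra_simps)
  qed
  have "((\<lambda>x. norm (f x - \<i> * f (x + c))) \<longlongrightarrow> norm (0 - \<i> * 0 :: complex)) F"
    using lim unfolding f_def[symmetric] by (intro tendsto_intros lim')
  moreover have "norm (f x - \<i> * f (x + c)) = 2 * norm a" for x
  proof -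
    have "f x - \<i> * f (x + c) = 2 * a * exp (\<i> * of_real k * of_real x)"
      unfolding shift unfolding f_def by (simp add: algebra_simps)
    then show ?thesis by (simp add: norm_mult)
  qed
  ultimately show "a = 0" using nF by (simp add: tendsto_const_iff)
  have "((\<lambda>x. norm (f x + \<i> * f (x + c))) \<longlongrightarrow> norm (0 + \<i> * 0 :: complex)) F"
    using lim unfolding f_def[symmetric] by (intro tendsto_intros lim')
  moreover have "norm (f x + \<i> * f (x + c)) = 2 * norm b" for x
  proof -
    have "f x + \<i> * f (x + c) = 2 * b * exp (- (\<i> * of_real k) * of_real x)"
      unfolding shift unfolding f_def by (simp add: algebra_simps)
    then show ?thesis by (simp add: norm_mult)
  qed
  ultimately show "b = 0" using nF by (simp add: tendsto_const_iff)
qed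

text \<open>For imaginary \<open>z\<close> the exponential has modulus 1, so the limit of
  \<open>P n x z\<close> carries over; \<open>\<sigma>\<close> is the limit of \<open>tanh\<close>
  along \<open>F\<close>.\<close>

lemma ladder_wave_asymptotics:
  assumes z: "Re z = 0" and F: "F = at_top \<and> \<sigma> = 1 \<or> F = at_bot \<and> \<sigma> = -1"
  shows "((\<lambda>x. ladder_wave n z x - (\<Prod>j=1..n. z - \<sigma> * of_nat j) * exp (z * of_real x)) \<longlongrightarrow> 0) F"
proof -
  have "((\<lambda>x. P n x z) \<longlongrightarrow> (\<Prod>j=1..n. z - \<sigma> * of_nat j)) F"
  proof -
    have "((\<lambda>x. complex_of_real (tanh x)) \<longlongrightarrow> \<sigma>) F"
      using F tendsto_of_real[OF tanh_real_at_top] tendsto_of_real[OF tanh_real_at_bot] by auto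
    then have "((\<lambda>x. P n x z) \<longlongrightarrow> poly (ladder_poly n z) \<sigma>) F"
      unfolding P_eq_ladder_poly by (intro tendsto_intros)
    then show ?thesis using F by (auto simp: poly_ladder_poly_1 poly_ladder_poly_minus_1)
  qed
  then have "((\<lambda>x. P n x z - (\<Prod>j=1..n. z - \<sigma> * of_nat j)) \<longlongrightarrow> 0) F"
    by (rule LIM_zero)
  then show ?thesis
    by (rule Lim_null_comparison[rotated, OF tendsto_norm_zero])
       (simp add: ladder_wave_def norm_mult z flip: left_diff_distrib)
qed

text \<open>Subtracting the asymptotics of both waves leaves a pure oscillation tending to zero,
  whose coefficients must vanish.\<close>

lemma amplitudes_unique:
  fixes k :: real
  assumes h: "((\<lambda>x. (a * ladder_wave n (\<i> * of_real k) x + b * ladder_wave n (- (\<i> * of_real k)) x)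
      - (\<alpha> * exp (\<i> * of_real k * of_real x) + \<beta> * exp (- (\<i> * of_real k) * of_real x))) \<longlongrightarrow> 0) F"
    and k: "k \<noteq> 0" and F: "F = at_top \<and> \<sigma> = 1 \<or> F = at_bot \<and> \<sigma> = -1"
  shows "a * (\<Prod>j=1..n. \<i> * of_real k - \<sigma> * of_nat j) = \<alpha>"
    and "b * (\<Prod>j=1..n. - (\<i> * of_real k) - \<sigma> * of_nat j) = \<beta>"
proof -
  define z where "z = \<i> * complex_of_real k"
  define A where "A \<zeta> = (\<Prod>j=1..n. \<zeta> - \<sigma> * of_nat j)" for \<zeta>
  have w: "((\<lambda>x. ladder_wave n \<zeta> x - A \<zeta> * exp (\<zeta> * of_real x)) \<longlongrightarrow> 0) F" if "Re \<zeta> = 0" for \<zeta>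
    unfolding A_def by (rule ladder_wave_asymptotics[OF that F])
  have "((\<lambda>x. (a * ladder_wave n z x + b * ladder_wave n (- z) x)
      - (\<alpha> * exp (z * of_real x) + \<beta> * exp (- z * of_real x))
      - a * (ladder_wave n z x - A z * exp (z * of_real x))
      - b * (ladder_wave n (- z) x - A (- z) * exp (- z * of_real x))) \<longlongrightarrow> 0 - a * 0 - b * 0) F"
    using h unfolding z_def[symmetric] by (intro tendsto_diff tendsto_mult tendsto_const w) (auto simp: z_def)
  then have "((\<lambda>x. (a * A z - \<alpha>) * exp (z * of_real x) + (b * A (- z) - \<beta>) * exp (- z * of_real x)) \<longlongrightarrow> 0) F"
    by (simp add: algebra_simps)
  from tendsto_oscillation_zeroD[OF this[unfolded z_def] k] F
  show "a * (\<Prod>j=1..n. \<i> * of_real k - \<sigma> * of_nat j) = \<alpha>"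
    and "b * (\<Prod>j=1..n. - (\<i> * of_real k) - \<sigma> * of_nat j) = \<beta>"
    by (auto simp: A_def z_def)
qed

section \<open>Distorted plane waves\<close>

lemma scattering_solution_unique:
  assumes f: "scattering_solution n k f" and g: "scattering_solution n k g" and k: "k \<noteq> 0"
  shows "f = g"
proof -
  define z where "z = \<i> * complex_of_real k"
  define h where "h x = f x - g x" for x
  \<comment> \<open>\<open>F\<close> is the end of the transmitted wave, \<open>G\<close> the end of
    the incident and reflected ones; \<open>\<sigma>\<close> and \<open>- \<sigma>\<close> are the
    limits of \<open>tanh\<close> there.\<close>
  define F G where "F = (if k > 0 then at_top else at_bot :: real filter)"
    and "G = (if k > 0 then at_bot else at_top :: real filter)"
  define \<sigma> where "\<sigma> = complex_of_real (sgn k)"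
  have FG: "F = at_top \<and> \<sigma> = 1 \<or> F = at_bot \<and> \<sigma> = -1"
    "G = at_top \<and> - \<sigma> = 1 \<or> G = at_bot \<and> - \<sigma> = -1"
    using k by (auto simp: F_def G_def \<sigma>_def sgn_if)
  have ex: "exp (\<i> * of_real (k * x)) = exp (z * of_real x)"
    "exp (- \<i> * of_real (k * x)) = exp (- z * of_real x)" for x
    by (simp_all add: z_def mult_ac)
  have asym: "\<exists>T R. ((\<lambda>x. u x - T * exp (z * of_real x)) \<longlongrightarrow> 0) F \<and>
      ((\<lambda>x. u x - (exp (z * of_real x) + R * exp (- z * of_real x))) \<longlongrightarrow> 0) G"
    if "scattering_solution n k u" for u
    using that k unfolding scattering_solution_def ex by (cases "k > 0") (auto simp: F_def G_def)
  obtain T R where f': "((\<lambda>x. f x - T * exp (z * of_real x)) \<longlongrightarrow> 0) F"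
    "((\<lambda>x. f x - (exp (z * of_real x) + R * exp (- z * of_real x))) \<longlongrightarrow> 0) G"
    using asym[OF f] by blast
  obtain T' R' where g': "((\<lambda>x. g x - T' * exp (z * of_real x)) \<longlongrightarrow> 0) F"
    "((\<lambda>x. g x - (exp (z * of_real x) + R' * exp (- z * of_real x))) \<longlongrightarrow> 0) G"
    using asym[OF g] by blast
  have "schroedinger_solution n k h"
    using f g unfolding h_def[abs_def] scattering_solution_def by (blast intro: schroedinger_solution_diff)
  then obtain a b where h: "\<And>x. h x = a * ladder_wave n z x + b * ladder_wave n (- z) x"
    using schroedinger_solution_span[OF _ k] unfolding z_def by blast
  \<comment> \<open>At \<open>F\<close> the difference has no \<open>exp (- z x)\<close> component,
    which forces \<open>b = 0\<close>; at \<open>G\<close> the incident waves cancel, which forces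
    \<open>a = 0\<close>.\<close>
  have "((\<lambda>x. h x - ((T - T') * exp (z * of_real x) + 0 * exp (- z * of_real x))) \<longlongrightarrow> 0) F"
    using tendsto_diff[OF f'(1) g'(1)] by (simp add: h_def algebra_simps)
  then have b: "b * (\<Prod>j=1..n. - z - \<sigma> * of_nat j) = 0"
    unfolding h z_def by (rule amplitudes_unique[OF _ k FG(1)])
  have "((\<lambda>x. h x - (0 * exp (z * of_real x) + (R - R') * exp (- z * of_real x))) \<longlongrightarrow> 0) G"
    using tendsto_diff[OF f'(2) g'(2)] by (simp add: h_def algebra_simps)
  then have a: "a * (\<Prod>j=1..n. z - - \<sigma> * of_nat j) = 0"
    unfolding h z_def by (rule amplitudes_unique[OF _ k FG(2)])
  \<comment> \<open>Each factor has imaginary part \<open>k\<close> or \<open>- k\<close>.\<close>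
  have nz: "z - - \<sigma> * of_nat j \<noteq> 0" "- z - \<sigma> * of_nat j \<noteq> 0" for j
    using k by (auto simp: z_def \<sigma>_def complex_eq_iff)
  from a b have "a = 0" "b = 0" using nz by (simp_all del: diff_minus_eq_add)
  then show ?thesis using h unfolding h_def by auto
qed

section \<open>The normalized scattering solution\<close>

text \<open>For \<open>k \<noteq> 0\<close> this is the reciprocal of the limit of
  \<open>P n x (\<i> k)\<close> at the end where the wave comes in, so it normalizes the incident
  wave.\<close>

definition amplitude :: "nat \<Rightarrow> real \<Rightarrow> complex" where
  "amplitude n k = of_real (sgn k) ^ n * (\<Prod>j=1..n. 1 / (of_nat j + \<i> * of_real \<bar>k\<bar>))"

lemma scattering_solution_ladder_wave:
  assumes k: "k \<noteq> 0"
  shows "scattering_solution n k (\<lambda>x. amplitude n k * ladder_wave n (\<i> * of_real k) x)"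
proof -
  define z where "z = \<i> * complex_of_real k"
  have ex: "exp (\<i> * of_real (k * x)) = exp (z * of_real x)"
    "exp (- \<i> * of_real (k * x)) = exp (- z * of_real x)" for x
    by (simp_all add: z_def mult_ac)
  have lim: "((\<lambda>x. amplitude n k * ladder_wave n z x -
      amplitude n k * (\<Prod>j=1..n. z - \<tau> * of_nat j) * exp (z * of_real x)) \<longlongrightarrow> 0) F"
    if "F = at_top \<and> \<tau> = 1 \<or> F = at_bot \<and> \<tau> = -1" for \<tau> F
    using tendsto_mult_right_zero[OF ladder_wave_asymptotics[OF _ that, of z n], of "amplitude n k"]
    by (simp add: z_def algebra_simps)
  have one: "amplitude n k * (\<Prod>j=1..n. z - - of_real (sgn k) * of_nat j) = 1"
  proof -
    have "z - - of_real (sgn k) * of_nat j = of_real (sgn k) * (of_nat j + \<i> * of_real \<bar>k\<bar>)" for j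
      using k by (simp add: z_def sgn_if algebra_simps)
    then have "(\<Prod>j=1..n. z - - of_real (sgn k) * of_nat j) =
        of_real (sgn k) ^ n * (\<Prod>j=1..n. of_nat j + \<i> * of_real \<bar>k\<bar>)"
      by (simp only: prod.distrib) simp
    moreover have "of_real (sgn k) ^ n * of_real (sgn k) ^ n = (1 :: complex)"
      using k by (auto simp: sgn_if simp flip: power_mult_distrib)
    moreover have "(\<Prod>j=1..n. of_nat j + \<i> * complex_of_real \<bar>k\<bar>) \<noteq> 0"
    proof -
      have "of_nat j + \<i> * complex_of_real \<bar>k\<bar> \<noteq> 0" for j
        using k by (simp add: complex_eq_iff)
      then show ?thesis by simp
    qed
    ultimately show ?thesis
      by (simp add: amplitude_def prod_dividef mult_ac)
  qed
  have "schroedinger_solution n k (\<lambda>x. amplitude n k * ladder_wave n z x)"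
    by (rule schroedinger_solution_ladder_wave) (simp add: z_def power_mult_distrib)
  moreover have "\<exists>T R :: complex.
        (k > 0 \<longrightarrow>
           ((\<lambda>x. amplitude n k * ladder_wave n z x - T * exp (z * of_real x)) \<longlongrightarrow> 0) at_top \<and>
           ((\<lambda>x. amplitude n k * ladder_wave n z x - (exp (z * of_real x) + R * exp (- z * of_real x))) \<longlongrightarrow> 0) at_bot) \<and>
        (k < 0 \<longrightarrow>
           ((\<lambda>x. amplitude n k * ladder_wave n z x - T * exp (z * of_real x)) \<longlongrightarrow> 0) at_bot \<and>
           ((\<lambda>x. amplitude n k * ladder_wave n z x - (exp (z * of_real x) + R * exp (- z * of_real x))) \<longlongrightarrow> 0) at_top)"
    \<comment> \<open>The potential is reflectionless, so \<open>R = 0\<close>; \<open>T\<close> is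
      the amplitude times the limit of \<open>P\<close> at the transmission end.\<close>
    using one k lim[of at_top 1] lim[of at_bot "-1"]
    by (intro exI[of _ "amplitude n k * (\<Prod>j=1..n. z - of_real (sgn k) * of_nat j)"] exI[of _ 0]) auto
  ultimately show ?thesis
    unfolding scattering_solution_def ex z_def by blast
qed

text \<open>Existence and uniqueness together evaluate the definite description.\<close>

lemma ewave_eq:
  assumes "k \<noteq> 0"
  shows "ewave n x k = amplitude n k * ladder_wave n (\<i> * of_real k) x"
proof -
  have "(THE f. scattering_solution n k f) = (\<lambda>x. amplitude n k * ladder_wave n (\<i> * of_real k) x)"
    using scattering_solution_ladder_wave[OF assms] scattering_solution_unique[OF _ _ assms] by blast
  then show ?thesis by (simp add: ewave_def)
qed

lemma ladder_wave_minus: "ladder_wave n z (- x) = (- 1) ^ n * ladder_wave n (- z) x"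
  by (simp add: ladder_wave_def P_minus)

text \<open>The sign \<open>(- 1) ^ n\<close> from the amplitude cancels the one from the parity of
  the ladder wave.\<close>

lemma ewave_minus:
  assumes "k \<noteq> 0"
  shows "ewave n x (- k) = ewave n (- x) k"
proof -
  have "amplitude n (- k) = (- 1) ^ n * amplitude n k"
    by (simp add: amplitude_def sgn_minus power_minus[of "of_real (sgn k)"])
  then show ?thesis using assms by (simp add: ewave_eq ladder_wave_minus)
qed

text \<open>The sign has modulus 1 and each denominator has squared modulus
  \<open>j\<^sup>2 + k\<^sup>2\<close>; thus \<open>sgn k\<close> and \<open>\<bar>k\<bar>\<close>
  disappear, and with them the singular behaviour at \<open>k = 0\<close>.\<close>

lemma amplitude_mult_cnj:
  assumes "k \<noteq> 0"
  shows "amplitude n k * cnj (amplitude n k) = of_real (\<Prod>j=1..n. 1 / ((real j)\<^sup>2 + k\<^sup>2))"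
proof -
  have "amplitude n k * cnj (amplitude n k) = of_real ((norm (amplitude n k))\<^sup>2)"
    by (simp add: complex_norm_square del: of_real_power)
  also have "(norm (amplitude n k))\<^sup>2 = (\<Prod>j=1..n. (norm (1 / (of_nat j + \<i> * of_real \<bar>k\<bar>)))\<^sup>2)"
    using assms unfolding amplitude_def norm_mult norm_power prod_norm[symmetric] prod_power_distrib[symmetric]
    by (simp add: sgn_if)
  also have "\<dots> = (\<Prod>j=1..n. 1 / ((real j)\<^sup>2 + k\<^sup>2))"
    by (intro prod.cong refl) (simp add: norm_divide power_divide cmod_power2)
  finally show ?thesis .
qed

lemma ladder_wave_mult_reflected:
  "ladder_wave n (\<i> * of_real k) x * ladder_wave n (- (\<i> * of_real k)) y =
     P n x (\<i> * of_real k) * P n y (- (\<i> * of_real k)) * exp (\<i> * of_real (k * (x - y)))"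
proof -
  have "exp (\<i> * of_real (k * (x - y))) =
      exp (\<i> * of_real k * of_real x) * exp (- (\<i> * of_real k) * of_real y)"
    by (simp add: algebra_simps flip: exp_add)
  then show ?thesis by (simp only: ladder_wave_def mult_ac)
qed

text \<open>Since \<open>\<i> k\<close> is imaginary, conjugating the wave replaces it by
  \<open>- \<i> k\<close>.\<close>

lemma ewave_mult_cnj:
  assumes "k \<noteq> 0"
  shows "ewave n x k * cnj (ewave n y k) = of_real (\<Prod>j=1..n. 1 / ((real j)\<^sup>2 + k\<^sup>2))
    * P n x (\<i> * of_real k) * P n y (- (\<i> * of_real k)) * exp (\<i> * of_real (k * (x - y)))"
proof -
  have "cnj (ladder_wave n (\<i> * of_real k) y) = ladder_wave n (- (\<i> * of_real k)) y"
    by (simp add: ladder_wave_def cnj_P exp_cnj)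
  then have "ewave n x k * cnj (ewave n y k) = amplitude n k * cnj (amplitude n k) *
      (ladder_wave n (\<i> * of_real k) x * ladder_wave n (- (\<i> * of_real k)) y)"
    by (simp only: ewave_eq[OF assms] complex_cnj_mult mult_ac)
  then show ?thesis
    unfolding amplitude_mult_cnj[OF assms] ladder_wave_mult_reflected by (simp only: mult.assoc)
qed

section \<open>Joint analyticity in position and momentum\<close>

lemma real_analytic_at_coeff_ladder_poly:
  assumes "\<zeta> real_analytic_on {a}"
  shows "(\<lambda>p. coeff (ladder_poly m (\<zeta> p)) i) real_analytic_on {a}"
proof (induction m arbitrary: i)
  case 0
  show ?case by (simp add: real_analytic_at_const)
next
  case (Suc m)
  note intros = real_analytic_at_const real_analytic_at_add real_analytic_at_diff
    real_analytic_at_mult assms Suc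
  \<comment> \<open>The term from \<open>t\<^sup>2\<close> times the derivative should start at
    \<open>i = 2\<close>; its factor \<open>i - 1\<close> vanishes at \<open>i = 1\<close>, so only
    \<open>i = 0\<close> needs a case.\<close>
  have *: "coeff (ladder_poly (Suc m) z) i =
      of_nat (i + 1) * coeff (ladder_poly m z) (i + 1)
      - of_nat (i - 1) * (if i = 0 then 0 else coeff (ladder_poly m z) (i - 1))
      + z * coeff (ladder_poly m z) i
      - of_nat (Suc m) * (if i = 0 then 0 else coeff (ladder_poly m z) (i - 1))" for z
    by (cases i; cases "i - 1") (simp_all add: coeff_pderiv coeff_pCons algebra_simps)
  show ?case
  proof (cases "i = 0")
    case True
    show ?thesis unfolding * if_P[OF True] by (intro intros)
  next
    case False
    show ?thesis unfolding * if_not_P[OF False] by (intro intros)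
  qed
qed

lemma complex_tanh_of_real: "tanh (complex_of_real x) = of_real (tanh x)"
  by (simp add: tanh_def sinh_def cosh_def scaleR_conv_of_real exp_of_real flip: of_real_minus)

text \<open>\<open>e\<close> is the position and \<open>e'\<close> the momentum direction.
  \<open>P\<close> is a finite sum of coefficients depending on the momentum times powers of
  \<open>tanh\<close>, and the remaining factor is a bilinear phase.\<close>

lemma real_analytic_at_ladder_wave:
  fixes a :: "'a::euclidean_space"
  assumes e: "e \<in> Basis" "e' \<in> Basis" "e \<noteq> e'"
  shows "(\<lambda>p. ladder_wave n (c * of_real (p \<bullet> e')) (p \<bullet> e)) real_analytic_on {a}"
proof -
  have "(\<lambda>p. tanh (complex_of_real (p \<bullet> e))) real_analytic_on {a}"
  proof (rule real_analytic_at_holomorphic_coordinate[OF _ _ _ e(1)])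
    \<comment> \<open>Complex \<open>tanh\<close> is holomorphic off the zeros of
      \<open>cosh\<close>, none of which is real.\<close>
    let ?S = "{w :: complex. cosh w \<noteq> 0}"
    show "tanh holomorphic_on ?S"
      using has_field_derivative_tanh[OF _ DERIV_ident]
      by (auto simp: holomorphic_on_def field_differentiable_def intro: has_field_derivative_at_within)
    show "open ?S"
      by (intro open_Collect_neq continuous_intros)
    have "cosh (complex_of_real x) = of_real (cosh x)" for x
      by (simp add: cosh_def scaleR_conv_of_real exp_of_real flip: of_real_minus)
    then show "complex_of_real (a \<bullet> e) \<in> ?S" by simp
  qed
  then have t: "(\<lambda>p. complex_of_real (tanh (p \<bullet> e))) real_analytic_on {a}"
    by (simp add: complex_tanh_of_real)
  have z: "(\<lambda>p. c * of_real (p \<bullet> e')) real_analytic_on {a}"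
    by (rule real_analytic_at_holomorphic_coordinate[of _ UNIV]) (auto intro!: holomorphic_intros e)
  have "P n x z = (\<Sum>i\<le>n. coeff (ladder_poly n z) i * of_real (tanh x) ^ i)" for x z
    unfolding P_eq_ladder_poly poly_altdef
    using degree_ladder_poly[of n z]
    by (intro sum.mono_neutral_left) (auto simp: coeff_eq_0)
  then have "(\<lambda>p. P n (p \<bullet> e) (c * of_real (p \<bullet> e'))) real_analytic_on {a}"
    by (simp only:) (intro real_analytic_at_sum real_analytic_at_mult real_analytic_at_power
        real_analytic_at_coeff_ladder_poly z t)
  then show ?thesis
    unfolding ladder_wave_def using e
    by (intro real_analytic_at_mult real_analytic_at_exp_bilinear) auto
qed

text \<open>Because \<open>c\<close> is imaginary, the denominators have real part
  \<open>j \<ge> 1\<close> at real points.\<close>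

lemma real_analytic_at_prod_inverse:
  fixes a :: "'a::euclidean_space"
  assumes e: "e \<in> Basis" and c: "Re c = 0"
  shows "(\<lambda>p. \<Prod>j=1..n. 1 / (of_nat j + c * of_real (p \<bullet> e))) real_analytic_on {a}"
proof (rule real_analytic_at_holomorphic_coordinate[OF _ _ _ e])
  let ?S = "{w. \<forall>j\<in>{1..n}. of_nat j + c * w \<noteq> 0}"
  show "(\<lambda>w. \<Prod>j=1..n. 1 / (of_nat j + c * w)) holomorphic_on ?S"
    by (intro holomorphic_intros) auto
  have "?S = (\<Inter>j\<in>{1..n}. {w. of_nat j + c * w \<noteq> 0})" by auto
  also have "open \<dots>" by (intro open_INT ballI open_Collect_neq continuous_intros) auto
  finally show "open ?S" .
  show "complex_of_real (a \<bullet> e) \<in> ?S" using c by (auto simp: complex_eq_iff)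
qed

text \<open>Near a point with \<open>k0 \<noteq> 0\<close> the sign of \<open>k\<close> is constant,
  so freezing it as \<open>s\<close> turns \<open>\<bar>k\<bar>\<close> into the analytic expression
  \<open>s k\<close>.\<close>

lemma real_analytic_ewave:
  "(\<lambda>(x, k). ewave n x k) real_analytic_on (UNIV \<times> (UNIV - {0}))"
  unfolding real_analytic_on_pointwise[of _ "UNIV \<times> (UNIV - {0})"]
proof
  fix a :: "real \<times> real" assume "a \<in> UNIV \<times> (UNIV - {0})"
  then obtain x0 k0 where a: "a = (x0, k0)" and k0: "k0 \<noteq> 0" by auto
  define s where "s = sgn k0"
  define g :: "real \<times> real \<Rightarrow> complex" where
    "g p = of_real s ^ n * (\<Prod>j=1..n. 1 / (of_nat j + \<i> * of_real s * of_real (p \<bullet> (0, 1))))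
       * ladder_wave n (\<i> * of_real (p \<bullet> (0, 1))) (p \<bullet> (1, 0))" for p
  have "g real_analytic_on {(x0, k0)}"
    unfolding g_def[abs_def]
    by (intro real_analytic_at_mult real_analytic_at_const real_analytic_at_prod_inverse
        real_analytic_at_ladder_wave) (auto simp: Basis_prod_def)
  moreover have "eventually (\<lambda>p. g p = (\<lambda>(x, k). ewave n x k) p) (nhds (x0, k0))"
  proof (rule eventually_nhds_in_open[THEN eventually_mono])
    show "open {p :: real \<times> real. s * snd p > 0}"
      by (intro open_Collect_less continuous_intros)
    show "(x0, k0) \<in> {p. s * snd p > 0}" using k0 by (auto simp: s_def sgn_if)
    fix p :: "real \<times> real" assume p: "p \<in> {p. s * snd p > 0}"
    obtain x k where xk: "p = (x, k)" by (cases p)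
    have k: "k \<noteq> 0" "sgn k = s" "\<bar>k\<bar> = s * k"
      using p unfolding xk by (cases k0 "0 :: real" rule: linorder_cases; simp add: s_def)+
    have "\<i> * of_real s * of_real k = \<i> * complex_of_real \<bar>k\<bar>" by (simp add: k(3))
    moreover have "(x, k) \<bullet> (0, 1) = k" "(x, k) \<bullet> (1, 0) = x" by simp_all
    ultimately show "g p = (\<lambda>(x, k). ewave n x k) p"
      by (simp only: g_def xk prod.case ewave_eq[OF k(1)] amplitude_def k(2))
  qed
  ultimately show "(\<lambda>(x, k). ewave n x k) real_analytic_on {a}"
    unfolding a by (rule real_analytic_at_cong)
qed

lemma real_analytic_kernel:
  "(\<lambda>(x :: real, y :: real, k :: real). of_real (\<Prod>j=1..n. 1 / ((real j)\<^sup>2 + k\<^sup>2))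
     * P n x (\<i> * of_real k) * P n y (- (\<i> * of_real k)) * exp (\<i> * of_real (k * (x - y))))
   real_analytic_on UNIV"
proof -
  \<comment> \<open>Splitting \<open>j\<^sup>2 + k\<^sup>2 = (j + \<i> k) (j - \<i> k)\<close>
    reduces the prefactor to two products that are analytic also at \<open>k = 0\<close>.\<close>
  have factor: "complex_of_real (\<Prod>j=1..n. 1 / ((real j)\<^sup>2 + k\<^sup>2)) =
      (\<Prod>j=1..n. 1 / (of_nat j + \<i> * of_real k)) * (\<Prod>j=1..n. 1 / (of_nat j + - \<i> * of_real k))" for k
    unfolding prod.distrib[symmetric] of_real_prod
    by (intro prod.cong refl) (simp add: algebra_simps power2_eq_square)
  have "(\<lambda>(x, y, k). of_real (\<Prod>j=1..n. 1 / ((real j)\<^sup>2 + k\<^sup>2))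
      * P n x (\<i> * of_real k) * P n y (- (\<i> * of_real k)) * exp (\<i> * of_real (k * (x - y)))) =
    (\<lambda>p :: real \<times> real \<times> real.
      (\<Prod>j=1..n. 1 / (of_nat j + \<i> * of_real (p \<bullet> (0, 0, 1)))) *
      (\<Prod>j=1..n. 1 / (of_nat j + - \<i> * of_real (p \<bullet> (0, 0, 1)))) *
      (ladder_wave n (\<i> * of_real (p \<bullet> (0, 0, 1))) (p \<bullet> (1, 0, 0)) *
       ladder_wave n (- \<i> * of_real (p \<bullet> (0, 0, 1))) (p \<bullet> (0, 1, 0))))" (is "?f = ?g")
  proof
    fix p :: "real \<times> real \<times> real"
    obtain x y k where p: "p = (x, y, k)" by (cases p)
    show "?f p = ?g p"
      unfolding factor[symmetric]
      unfolding p prod.case mult_minus_left mult.assoc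
      by (simp add: ladder_wave_mult_reflected mult.assoc)
  qed
  moreover have "?g real_analytic_on UNIV"
    unfolding real_analytic_on_pointwise[of _ UNIV]
    by (intro ballI real_analytic_at_mult real_analytic_at_prod_inverse real_analytic_at_ladder_wave)
       (auto simp: Basis_prod_def zero_prod_def)
  ultimately show ?thesis by (simp only:)
qed

theorem theorem1p4:
  fixes n :: nat
  shows
    "(\<forall>(k::real) (x::real). k \<noteq> 0 \<longrightarrow>
        ewave n x k =
          of_real (sgn k) ^ n * (\<Prod>j=1..n. 1 / (of_nat j + \<i> * of_real \<bar>k\<bar>))
            * P n x (\<i> * of_real k) * exp (\<i> * of_real (k * x))) \<and>
     (\<lambda>(x, k). ewave n x k) real_analytic_on (UNIV \<times> (UNIV - {0})) \<and>
     (\<forall>(k::real) (x::real). k \<noteq> 0 \<longrightarrow> ewave n x (- k) = ewave n (- x) k) \<and>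
     (\<forall>(k::real) (x::real) (y::real). k \<noteq> 0 \<longrightarrow>
        ewave n x k * cnj (ewave n y k) =
          of_real (\<Prod>j=1..n. 1 / ((real j)\<^sup>2 + k\<^sup>2))
            * P n x (\<i> * of_real k) * P n y (- (\<i> * of_real k)) * exp (\<i> * of_real (k * (x - y)))) \<and>
     (\<lambda>(x::real, y::real, k::real).
        if k \<noteq> 0 then ewave n x k * cnj (ewave n y k)
        else of_real (\<Prod>j=1..n. 1 / ((real j)\<^sup>2 + k\<^sup>2))
            * P n x (\<i> * of_real k) * P n y (- (\<i> * of_real k)) * exp (\<i> * of_real (k * (x - y))))
       real_analytic_on UNIV"
proof (intro conjI allI impI)
  fix k x :: real assume "k \<noteq> 0"
  then show "ewave n x k = of_real (sgn k) ^ n * (\<Prod>j=1..n. 1 / (of_nat j + \<i> * of_real \<bar>k\<bar>))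
      * P n x (\<i> * of_real k) * exp (\<i> * of_real (k * x))"
    by (simp add: ewave_eq amplitude_def ladder_wave_def mult_ac)
next
  show "(\<lambda>(x, k). ewave n x k) real_analytic_on (UNIV \<times> (UNIV - {0}))"
    by (rule real_analytic_ewave)
next
  fix k x :: real assume "k \<noteq> 0"
  then show "ewave n x (- k) = ewave n (- x) k" by (rule ewave_minus)
next
  fix k x y :: real assume "k \<noteq> 0"
  then show "ewave n x k * cnj (ewave n y k) = of_real (\<Prod>j=1..n. 1 / ((real j)\<^sup>2 + k\<^sup>2))
      * P n x (\<i> * of_real k) * P n y (- (\<i> * of_real k)) * exp (\<i> * of_real (k * (x - y)))"
    by (rule ewave_mult_cnj)
next
  show "(\<lambda>(x::real, y::real, k::real).
        if k \<noteq> 0 then ewave n x k * cnj (ewave n y k)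
        else of_real (\<Prod>j=1..n. 1 / ((real j)\<^sup>2 + k\<^sup>2))
            * P n x (\<i> * of_real k) * P n y (- (\<i> * of_real k)) * exp (\<i> * of_real (k * (x - y))))
       real_analytic_on UNIV"
    \<comment> \<open>By \<open>ewave_mult_cnj\<close> both branches equal the closed formula, so
      the piecewise function is the kernel already shown analytic.\<close>
    by (rule back_subst[of "\<lambda>f. f real_analytic_on UNIV", OF real_analytic_kernel[of n]])
       (auto simp: fun_eq_iff ewave_mult_cnj)
qed

end
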